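(* Let a zero-sum security game be given, and let $\mathbf p^*\in\Delta_{N_a}$, $\mathbf q^*\in\Delta_{N_d}$. Then $(\mathbf{p}^*,\mathbf{q}^* )$ is a Nash equilibrium of the game if and only if $\big(\pi_S(f(\mathbf{p}^* )),(\pi_S(g_1(\mathbf{q}^* )),\pi_S(g_2(\mathbf{q}^* )))\big)$ is an optimal solution (saddle point) of the compact minimax problem $$\min_{(\bar{\mathbf{q}}_1,\bar{\mathbf{q}}_2)\in H_d}\ \max_{\bar{\mathbf{p}}\in H_a}\ \bar{\mathbf{p}}^T\big(\widetilde{\mathbf{D}}^b\bar{\mathbf{q}}_1+\widetilde{\mathbf{D}}^l\bar{\mathbf{q}}_2\big).$$
   Context: Game: targets $[n]=\{1,\dots,n\}$. The attacker's pure strategies are $\mathcal{A}=\{A\subseteq[n] : |A|\le c\}$; the defender's pure strategies form a collection $\mathcal{D}\subseteq 2^{[n]}$. $N_a=|\mathcal A|$, $N_d=|\mathcal D|$. Mixed strategies are probability vectors $\mathbf p\in\Delta_{N_a}$, $\mathbf q\in\Delta_{N_d}$, indexed by $\mathcal A$ and $\mathcal D$. There are real set functions $B_a,L_a$ (attacker) and $B_d,L_d$ (defender). If $A$ and $D$ are played, the attacker gets $B_a(A\setminus D)+L_a(A\cap D)$ and the defender gets $B_d(A\cap D)+L_d(A\setminus D)$; $U_a(\mathbf p,\mathbf q),U_d(\mathbf p,\mathbf q)$ are the expected payoffs (bilinear extensions). Zero-sum: $B_a(A\setminus D)+L_d(A\setminus D)=0$ and $B_d(A\cap D)+L_a(A\cap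 D)=0$ for all $A,D$. Nash equilibrium: $U_d(\mathbf p^*,\mathbf q^* )\ge U_d(\mathbf p^*,\mathbf q)$ and $U_a(\mathbf p^*,\mathbf q^* )\ge U_a(\mathbf p,\mathbf q^* )$ for all $\mathbf p,\mathbf q$. Common utilities: $B_a^c(U)=\sum_{V\subseteq U}(-1)^{|U\setminus V|}B_a(V)$, and similarly $L_a^c,B_d^c,L_d^c$. Support set: $S=\{A\in\mathcal A : B_a^c(A)\neq0\text{ or }B_d^c(A)\ne0\text{ or }L_a^c(A)\ne0\text{ or }L_d^c(A)\neq 0\}$; $\pi_S$ restricts a vector indexed by $\mathcal A$ to the coordinates in $S$. Matrices: $\mathbf E$ is the $\mathcal A\times\mathcal A$ matrix with $\mathbf E_{A,U}=1$ if $U\subseteq A$, else $0$; $\mathbf J,\mathbf K$ are the $\mathcal A\times\mathcal D$ binary matrices with $\mathbf J_{A,D}=1$ iff $A\subseteq D^c=[n]\setminus D$ and $\mathbf K_{A,D}=1$ iff $A\subseteq D$. $\widetilde{\mathbf D}^b,\widetilde{\mathbf D}^l$ are the $S\times S$ diagonal matrices with diagonal entries $B_a^c(A)$, $L_a^c(A)$, $A\in S$. Maps and polytopes: $f(\mathbf p)=\mathbf E^T\mathbf p$, $g_1(\mathbf q)=\mathbf J\mathbf q$, $g_2(\mathbf q)=\mathbf K\mathbf q$; $H_a=\{\pi_S(f(\mathbf p)):\mathbf p\in\Delta_{N_a}\}$, $H_d=\{(\pi_S(g_1(\mathbf q)),\pi_S(g_2(\mathbf q))):\mathbf q\in\Delta_{N_d}\}$.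 A pair in $H_a\times H_d$ is an optimal solution (saddle point) of the minimax problem if its first component maximizes the objective over $H_a$ with the second fixed and its second component minimizes the objective over $H_d$ with the first fixed. *)

theory Defs
  imports Complex_Main "HOL-Library.FuncSet"
begin

text \<open>
  Vectors and matrices have sets of targets as indices, so they are represented as functions
  that are relevant only on an explicit finite index set. Vectors are kept extensional
  (equal to \<open>undefined\<close> off their index set), so that equality of functions is
  equality of vectors.
\<close>

definition simplex_on :: "'i set \<Rightarrow> ('i \<Rightarrow> real) set" where
  "simplex_on I = {x \<in> extensional I. (\<forall>i\<in>I. 0 \<le> x i) \<and> (\<Sum>i\<in>I. x i) = 1}"

definition mat_vec :: "'i set \<Rightarrow> 'j set \<Rightarrow> ('i \<Rightarrow> 'j \<Rightarrow> real) \<Rightarrow> ('j \<Rightarrow> real) \<Rightarrow> 'i \<Rightarrow> real" where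
  "mat_vec I J M x = (\<lambda>i\<in>I. \<Sum>j\<in>J. M i j * x j)"

definition mat_transpose :: "('i \<Rightarrow> 'j \<Rightarrow> real) \<Rightarrow> 'j \<Rightarrow> 'i \<Rightarrow> real" where
  "mat_transpose M = (\<lambda>j i. M i j)"

definition diag_mat :: "('i \<Rightarrow> real) \<Rightarrow> 'i \<Rightarrow> 'i \<Rightarrow> real" where
  "diag_mat d = (\<lambda>i j. if i = j then d i else 0)"

definition vec_add :: "'i set \<Rightarrow> ('i \<Rightarrow> real) \<Rightarrow> ('i \<Rightarrow> real) \<Rightarrow> 'i \<Rightarrow> real" where
  "vec_add I x y = (\<lambda>i\<in>I. x i + y i)"

definition vec_dot :: "'i set \<Rightarrow> ('i \<Rightarrow> real) \<Rightarrow> ('i \<Rightarrow> real) \<Rightarrow> real" where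
  "vec_dot I x y = (\<Sum>i\<in>I. x i * y i)"

definition saddle_point :: "'x set \<Rightarrow> 'y set \<Rightarrow> ('x \<Rightarrow> 'y \<Rightarrow> real) \<Rightarrow> 'x \<Rightarrow> 'y \<Rightarrow> bool" where
  "saddle_point X Y \<phi> x y \<longleftrightarrow>
     x \<in> X \<and> y \<in> Y \<and> (\<forall>x'\<in>X. \<phi> x' y \<le> \<phi> x y) \<and> (\<forall>y'\<in>Y. \<phi> x y \<le> \<phi> x y')"

record security_game =
  num_targets :: nat
  capacity :: nat  \<comment> \<open>the largest number of targets the attacker can attack\<close>
  defenses :: "nat set set"
  B_a :: "nat set \<Rightarrow> real"
  L_a :: "nat set \<Rightarrow> real"
  B_d :: "nat set \<Rightarrow> real"
  L_d :: "nat set \<Rightarrow> real"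

definition targets :: "security_game \<Rightarrow> nat set" where
  "targets G = {1..num_targets G}"

definition attacks :: "security_game \<Rightarrow> nat set set" where
  "attacks G = {A. A \<subseteq> targets G \<and> card A \<le> capacity G}"

definition valid_game :: "security_game \<Rightarrow> bool" where
  "valid_game G \<longleftrightarrow> defenses G \<subseteq> Pow (targets G)"

definition attacker_payoff :: "security_game \<Rightarrow> nat set \<Rightarrow> nat set \<Rightarrow> real" where
  "attacker_payoff G A D = B_a G (A - D) + L_a G (A \<inter> D)"

definition defender_payoff :: "security_game \<Rightarrow> nat set \<Rightarrow> nat set \<Rightarrow> real" where
  "defender_payoff G A D = B_d G (A \<inter> D) + L_d G (A - D)"

definition zero_sum :: "security_game \<Rightarrow> bool" where
  "zero_sum G \<longleftrightarrow>
     (\<forall>A\<in>attacks G. \<forall>D\<in>defenses G.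
        B_a G (A - D) + L_d G (A - D) = 0 \<and> B_d G (A \<inter> D) + L_a G (A \<inter> D) = 0)"

definition U_a :: "security_game \<Rightarrow> (nat set \<Rightarrow> real) \<Rightarrow> (nat set \<Rightarrow> real) \<Rightarrow> real" where
  "U_a G p q = (\<Sum>A\<in>attacks G. \<Sum>D\<in>defenses G. p A * q D * attacker_payoff G A D)"

definition U_d :: "security_game \<Rightarrow> (nat set \<Rightarrow> real) \<Rightarrow> (nat set \<Rightarrow> real) \<Rightarrow> real" where
  "U_d G p q = (\<Sum>A\<in>attacks G. \<Sum>D\<in>defenses G. p A * q D * defender_payoff G A D)"

definition nash_equilibrium ::
    "security_game \<Rightarrow> (nat set \<Rightarrow> real) \<Rightarrow> (nat set \<Rightarrow> real) \<Rightarrow> bool" where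
  "nash_equilibrium G p q \<longleftrightarrow>
     p \<in> simplex_on (attacks G) \<and> q \<in> simplex_on (defenses G) \<and>
     (\<forall>q'\<in>simplex_on (defenses G). U_d G p q \<ge> U_d G p q') \<and>
     (\<forall>p'\<in>simplex_on (attacks G). U_a G p q \<ge> U_a G p' q)"

definition common_utility :: "(nat set \<Rightarrow> real) \<Rightarrow> nat set \<Rightarrow> real" where
  "common_utility F U = (\<Sum>V\<in>Pow U. (- 1) ^ card (U - V) * F V)"

definition support_set :: "security_game \<Rightarrow> nat set set" where
  "support_set G = {A \<in> attacks G.
     common_utility (B_a G) A \<noteq> 0 \<or> common_utility (B_d G) A \<noteq> 0 \<or>
     common_utility (L_a G) A \<noteq> 0 \<or> common_utility (L_d G) A \<noteq> 0}"

definition proj_support :: "security_game \<Rightarrow> (nat set \<Rightarrow> real) \<Rightarrow> nat set \<Rightarrow> real" where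
  "proj_support G x = restrict x (support_set G)"

definition mat_E :: "nat set \<Rightarrow> nat set \<Rightarrow> real" where
  "mat_E A U = (if U \<subseteq> A then 1 else 0)"

definition mat_J :: "security_game \<Rightarrow> nat set \<Rightarrow> nat set \<Rightarrow> real" where
  "mat_J G A D = (if A \<subseteq> targets G - D then 1 else 0)"

definition mat_K :: "nat set \<Rightarrow> nat set \<Rightarrow> real" where
  "mat_K A D = (if A \<subseteq> D then 1 else 0)"

definition map_f :: "security_game \<Rightarrow> (nat set \<Rightarrow> real) \<Rightarrow> nat set \<Rightarrow> real" where
  "map_f G p = mat_vec (attacks G) (attacks G) (mat_transpose mat_E) p"

definition map_g1 :: "security_game \<Rightarrow> (nat set \<Rightarrow> real) \<Rightarrow> nat set \<Rightarrow> real" where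
  "map_g1 G q = mat_vec (attacks G) (defenses G) (mat_J G) q"

definition map_g2 :: "security_game \<Rightarrow> (nat set \<Rightarrow> real) \<Rightarrow> nat set \<Rightarrow> real" where
  "map_g2 G q = mat_vec (attacks G) (defenses G) mat_K q"

definition H_a :: "security_game \<Rightarrow> (nat set \<Rightarrow> real) set" where
  "H_a G = {proj_support G (map_f G p) | p. p \<in> simplex_on (attacks G)}"

definition H_d :: "security_game \<Rightarrow> ((nat set \<Rightarrow> real) \<times> (nat set \<Rightarrow> real)) set" where
  "H_d G = {(proj_support G (map_g1 G q), proj_support G (map_g2 G q)) | q.
              q \<in> simplex_on (defenses G)}"

definition compact_objective ::
    "security_game \<Rightarrow> (nat set \<Rightarrow> real) \<Rightarrow> (nat set \<Rightarrow> real) \<times> (nat set \<Rightarrow> real) \<Rightarrow> real" where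
  "compact_objective G = (\<lambda>p (q1, q2).
     let S = support_set G;
         Db = diag_mat (common_utility (B_a G));
         Dl = diag_mat (common_utility (L_a G))
     in vec_dot S p (vec_add S (mat_vec S S Db q1) (mat_vec S S Dl q2)))"

end

(* By Moebius inversion on the subset lattice, B_a (A - D) + L_a (A \<inter> D) is the sum over all V of
   [V \<subseteq> A] (B_a^c V [V \<subseteq> D^c] + L_a^c V [V \<subseteq> D]): the payoff matrix factors through the matrices E,
   J and K.  Hence the compact objective at the projected strategies is exactly U_a, and since
   U_d = - U_a in a zero-sum game, both sides of the equivalence say the same thing. *)

theory Submission
  imports Defs
begin

text \<open>Moebius inversion on the finite lattice \<open>Pow U\<close>. The sign depending on
  \<open>U - V\<close> splits into a factor for each set, which reduces the claim to the fact that
  the transform with sign \<open>(- 1) ^ card V\<close> is its own inverse.\<close>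

lemma sum_common_utility:
  assumes "finite U"
  shows "(\<Sum>V\<in>Pow U. common_utility F V) = F U"
proof -
  define g where "g S = (\<Sum>V\<in>Pow S. (- 1) ^ card V * F V)" for S
  have "common_utility F V = (- 1) ^ card V * g V" if "V \<in> Pow U" for V
    unfolding common_utility_def g_def sum_distrib_left
  proof (rule sum.cong)
    fix W assume "W \<in> Pow V"
    have fin: "finite V" "W \<subseteq> V"
      using that \<open>W \<in> Pow V\<close> assms finite_subset by auto
    \<comment> \<open>As \<open>W \<subseteq> V\<close>, the exponent is
      \<open>card V - card W\<close>, which has the same parity as
      \<open>card V + card W\<close>.\<close>
    have "(- 1 :: real) ^ card (V - W) = (- 1) ^ card V * (- 1) ^ card W"
      using fin
      by (simp add: card_Diff_subset finite_subset card_mono neg_one_power_add_eq_neg_one_power_diff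
          flip: power_add)
    then show "(- 1) ^ card (V - W) * F W = (- 1) ^ card V * ((- 1) ^ card W * F W)"
      by simp
  qed simp
  then have "(\<Sum>V\<in>Pow U. common_utility F V) = (\<Sum>V\<in>Pow U. (- 1) ^ card V * g V)"
    by (rule sum.cong[OF refl])
  also have "\<dots> = F U"
    using inclusion_exclusion_symmetric[of g F U] assms g_def by simp
  finally show ?thesis .
qed

lemma finite_attacks: "finite (attacks G)"
  by (rule finite_subset[of _ "Pow (targets G)"]) (auto simp: attacks_def targets_def)

lemma subset_in_attacks:
  assumes "A \<in> attacks G" "V \<subseteq> A"
  shows "V \<in> attacks G"
proof -
  have "finite A"
    using assms(1) by (auto simp: attacks_def targets_def intro: finite_subset)
  then show ?thesis
    using assms card_mono[of A V] by (auto simp: attacks_def)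
qed

text \<open>The attacks are closed under subsets, so the index set contains all of
  \<open>Pow U\<close> and Moebius inversion can be summed over the common index set
  \<open>attacks G\<close>, whatever \<open>U\<close> is.\<close>

lemma sum_common_utility_attacks:
  assumes "A \<in> attacks G" "U \<subseteq> A"
  shows "(\<Sum>V\<in>attacks G. if V \<subseteq> U then common_utility F V else 0) = F U"
proof -
  have eq: "{V \<in> attacks G. V \<subseteq> U} = Pow U"
    using subset_in_attacks[OF assms(1)] assms(2) by auto
  have "finite U"
    using assms by (auto simp: attacks_def targets_def intro: finite_subset)
  then show ?thesis
    by (simp add: sum_common_utility eq flip: sum.inter_filter[OF finite_attacks])
qed

lemma attacker_payoff_factorization:
  assumes "A \<in> attacks G"
  shows "attacker_payoff G A D =
    (\<Sum>V\<in>attacks G. mat_E A V *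
       (common_utility (B_a G) V * mat_J G V D + common_utility (L_a G) V * mat_K V D))"
proof -
  have A: "A \<subseteq> targets G"
    using assms by (simp add: attacks_def)
  \<comment> \<open>A product of containment indicators is the indicator of containment in the
    intersection; since \<open>A \<subseteq> targets G\<close>, intersecting \<open>A\<close> with
    the complement of \<open>D\<close> gives \<open>A - D\<close>.\<close>
  have "mat_E A V * (common_utility (B_a G) V * mat_J G V D + common_utility (L_a G) V * mat_K V D)
      = (if V \<subseteq> A - D then common_utility (B_a G) V else 0)
        + (if V \<subseteq> A \<inter> D then common_utility (L_a G) V else 0)" for V
  proof -
    have "V \<subseteq> A - D \<longleftrightarrow> V \<subseteq> A \<and> V \<subseteq> targets G - D" "V \<subseteq> A \<inter> D \<longleftrightarrow> V \<subseteq> A \<and> V \<subseteq> D"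
      using A by auto
    then show ?thesis
      by (simp only: mat_E_def mat_J_def mat_K_def) simp
  qed
  moreover have "(\<Sum>V\<in>attacks G. if V \<subseteq> A - D then common_utility (B_a G) V else 0) = B_a G (A - D)"
    "(\<Sum>V\<in>attacks G. if V \<subseteq> A \<inter> D then common_utility (L_a G) V else 0) = L_a G (A \<inter> D)"
    by (rule sum_common_utility_attacks[OF assms], blast)+
  ultimately show ?thesis
    by (simp add: attacker_payoff_def sum.distrib)
qed

lemma mat_vec_diag_mat:
  assumes "finite I" "i \<in> I"
  shows "mat_vec I I (diag_mat d) x i = d i * x i"
proof -
  have "(\<Sum>j\<in>I. diag_mat d i j * x j) = (\<Sum>j\<in>I. if i = j then d i * x j else 0)"
    by (rule sum.cong) (auto simp: diag_mat_def)
  then show ?thesis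
    using assms by (simp add: mat_vec_def)
qed

lemma compact_objective_eq_U_a:
  "compact_objective G (proj_support G (map_f G p))
     (proj_support G (map_g1 G q), proj_support G (map_g2 G q)) = U_a G p q"
proof -
  let ?A = "attacks G" and ?D = "defenses G" and ?S = "support_set G"
  let ?b = "common_utility (B_a G)" and ?l = "common_utility (L_a G)"
  have sub: "?S \<subseteq> ?A"
    by (auto simp: support_set_def)
  then have fin: "finite ?S"
    by (rule finite_subset) (rule finite_attacks)
  have "compact_objective G (proj_support G (map_f G p))
     (proj_support G (map_g1 G q), proj_support G (map_g2 G q))
     = (\<Sum>V\<in>?S. map_f G p V * (?b V * map_g1 G q V + ?l V * map_g2 G q V))"
    by (simp add: compact_objective_def vec_dot_def vec_add_def mat_vec_diag_mat fin proj_support_def)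
  \<comment> \<open>Projecting loses nothing: off the support set both \<open>?b V\<close> and
    \<open>?l V\<close> vanish, so the added terms are zero.\<close>
  also have "\<dots> = (\<Sum>V\<in>?A. map_f G p V * (?b V * map_g1 G q V + ?l V * map_g2 G q V))"
    by (rule sum.mono_neutral_left[OF finite_attacks sub]) (auto simp: support_set_def)
  also have "\<dots> = (\<Sum>V\<in>?A. \<Sum>A\<in>?A. \<Sum>D\<in>?D.
      p A * q D * (mat_E A V * (?b V * mat_J G V D + ?l V * mat_K V D)))"
  proof (rule sum.cong[OF refl])
    fix V assume V: "V \<in> ?A"
    have "map_f G p V = (\<Sum>A\<in>?A. mat_E A V * p A)"
      using V by (simp add: map_f_def mat_vec_def mat_transpose_def)
    moreover have "?b V * map_g1 G q V + ?l V * map_g2 G q V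
        = (\<Sum>D\<in>?D. q D * (?b V * mat_J G V D + ?l V * mat_K V D))"
      using V by (simp add: map_g1_def map_g2_def mat_vec_def sum_distrib_left algebra_simps
          flip: sum.distrib)
    ultimately show "map_f G p V * (?b V * map_g1 G q V + ?l V * map_g2 G q V) =
      (\<Sum>A\<in>?A. \<Sum>D\<in>?D. p A * q D * (mat_E A V * (?b V * mat_J G V D + ?l V * mat_K V D)))"
      by (simp only: sum_product) (simp add: mult_ac)
  qed
  \<comment> \<open>Moving \<open>V\<close> innermost collects, for each pair \<open>A\<close>,
    \<open>D\<close>, the factorized payoff.\<close>
  also have "\<dots> = (\<Sum>A\<in>?A. \<Sum>D\<in>?D. \<Sum>V\<in>?A.
      p A * q D * (mat_E A V * (?b V * mat_J G V D + ?l V * mat_K V D)))"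
    by (subst sum.swap) (intro sum.cong refl sum.swap)
  also have "\<dots> = U_a G p q"
    unfolding U_a_def
    by (intro sum.cong refl) (simp only: attacker_payoff_factorization sum_distrib_left)
  finally show ?thesis .
qed

lemma zero_sum_U_d:
  assumes "zero_sum G"
  shows "U_d G p q = - U_a G p q"
proof -
  have "defender_payoff G A D = - attacker_payoff G A D"
    if "A \<in> attacks G" "D \<in> defenses G" for A D
  proof -
    have "B_a G (A - D) + L_d G (A - D) = 0" "B_d G (A \<inter> D) + L_a G (A \<inter> D) = 0"
      using assms that by (auto simp: zero_sum_def)
    then show ?thesis
      by (simp add: defender_payoff_def attacker_payoff_def)
  qed
  then show ?thesis
    by (simp add: U_d_def U_a_def flip: sum_negf)
qed

theorem theorem5:
  fixes G :: security_game and p q :: "nat set \<Rightarrow> real"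
  assumes "valid_game G" and "zero_sum G"
    and "p \<in> simplex_on (attacks G)" and "q \<in> simplex_on (defenses G)"
  shows "nash_equilibrium G p q \<longleftrightarrow>
    saddle_point (H_a G) (H_d G) (compact_objective G)
      (proj_support G (map_f G p))
      (proj_support G (map_g1 G q), proj_support G (map_g2 G q))"
proof -
  have "proj_support G (map_f G p) \<in> H_a G"
    "(proj_support G (map_g1 G q), proj_support G (map_g2 G q)) \<in> H_d G"
    using assms(3,4) by (auto simp: H_a_def H_d_def)
  \<comment> \<open>\<open>H_a G\<close> and \<open>H_d G\<close> are images of the simplices, so
    deviations inside them are exactly the projected deviations of the players; the sign in
    \<open>U_d\<close> turns the defender's maximization into minimizing the objective.\<close>
  moreover have "(\<forall>x\<in>H_a G. P x) \<longleftrightarrow> (\<forall>p'\<in>simplex_on (attacks G). P (proj_support G (map_f G p')))" for P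
    by (auto simp: H_a_def)
  moreover have "(\<forall>y\<in>H_d G. P y) \<longleftrightarrow> (\<forall>q'\<in>simplex_on (defenses G).
      P (proj_support G (map_g1 G q'), proj_support G (map_g2 G q')))" for P
    by (auto simp: H_d_def)
  ultimately show ?thesis
    using assms(3,4)
    by (auto simp: nash_equilibrium_def saddle_point_def compact_objective_eq_U_a
        zero_sum_U_d[OF assms(2)])
qed

end
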